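(* Let $d=2$ and $n\ge 2$. Let $f$ be a stable update function, let the interaction distribution $\mathcal D$ on $\Omega$ have full support, and let $\mathcal U^{(0)}$ be any configuration of $n$ opinions in $\mathbb S^{1}$ which is not separable. Then, almost surely, $\mathcal U^{(t)}$ polarizes.
   Context: Model: fix integers $d,n\ge 2$. An opinion is a unit vector in $\mathbb R^d$, i.e. an element of $\mathbb S^{d-1}$; a configuration is an $n$-tuple $\mathcal U=(\vec u_1,\dots,\vec u_n)$ of opinions, and $A_{ij}:=\langle \vec u_i,\vec u_j\rangle$. An update function is a function $f:[-1,1]\to\mathbb R$. Let $\Omega=\{(i,j)\in[n]\times[n]: i\ne j\}$, let $\mathcal D$ be a probability distribution on $\Omega$ (full support means every element of $\Omega$ has positive probability), and let $I^{(1)},I^{(2)},\dots$ be i.i.d. with law $\mathcal D$. Given $\mathcal U^{(0)}$, define $\mathcal U^{(t+1)}$ from $\mathcal U^{(t)}$ as follows: if the interaction at this step is $(i,j)$ ("$j$ influences $i$"), then $\vec u_k^{(t+1)}=\vec u_k^{(t)}$ for $k\ne i$ and $\vec u_i^{(t+1)}=\vec w/\|\vec w\|$ with $\vec w=\vec u_i^{(t)}+f(A_{ij}^{(t)})\,\vec u_j^{(t)}$. A configuration is polarized if for all $i,j$ either $\vec u_i=\vec u_j$ or $\vec u_i=-\vec u_j$; a sequence $\mathcal U^{(t)}$ polarizes if $\lim_{t\to\infty}\mathcal U^{(t)}$ exists (in the standard topology) and is polarized. $f$ is stable if it is continuous and $\operatorname{sign}(f(A))=\operatorname{sign}(A)$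 for all $A\in[-1,1]$ (so $f(0)=0$, $f<0$ on $[-1,0)$, $f>0$ on $(0,1]$). A configuration is separable if $[n]$ can be partitioned into two nonempty sets $S,T$ with $\vec u_i\perp\vec u_j$ for all $i\in S$, $j\in T$. *)

theory Defs
  imports "HOL-Analysis.Analysis" "HOL-Probability.Probability"
begin

text \<open>Opinions in the plane (d = 2) are unit vectors of type real^2.
  A configuration of n opinions is a function from agent indices to opinions;
  only the indices i < n (i.e. [n] = {0..<n}) are relevant.\<close>

type_synonym config = "nat \<Rightarrow> real ^ 2"

definition opinion :: "real ^ 2 \<Rightarrow> bool" where
  "opinion u \<longleftrightarrow> norm u = 1"

definition is_config :: "nat \<Rightarrow> config \<Rightarrow> bool" where
  "is_config n U \<longleftrightarrow> (\<forall>i<n. opinion (U i))"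

definition interactions :: "nat \<Rightarrow> (nat \<times> nat) set" where
  "interactions n = {(i, j). i < n \<and> j < n \<and> i \<noteq> j}"

definition stable :: "(real \<Rightarrow> real) \<Rightarrow> bool" where
  "stable f \<longleftrightarrow> continuous_on {-1..1} f \<and> (\<forall>A\<in>{-1..1}. sgn (f A) = sgn A)"

definition polarized :: "nat \<Rightarrow> config \<Rightarrow> bool" where
  "polarized n U \<longleftrightarrow> (\<forall>i<n. \<forall>j<n. U i = U j \<or> U i = - U j)"

definition polarizes :: "nat \<Rightarrow> (nat \<Rightarrow> config) \<Rightarrow> bool" where
  "polarizes n Us \<longleftrightarrow>
     (\<exists>L. (\<forall>i<n. (\<lambda>t. Us t i) \<longlonglongrightarrow> L i) \<and> polarized n L)"

definition separable :: "nat \<Rightarrow> config \<Rightarrow> bool" where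
  "separable n U \<longleftrightarrow> (\<exists>S T. S \<noteq> {} \<and> T \<noteq> {} \<and> S \<inter> T = {} \<and> S \<union> T = {..<n} \<and>
      (\<forall>i\<in>S. \<forall>j\<in>T. inner (U i) (U j) = 0))"

definition update :: "(real \<Rightarrow> real) \<Rightarrow> nat \<times> nat \<Rightarrow> config \<Rightarrow> config" where
  "update f ij U = (case ij of (i, j) \<Rightarrow>
     (let w = U i + f (inner (U i) (U j)) *\<^sub>R U j in U(i := (1 / norm w) *\<^sub>R w)))"

text \<open>Trajectory driven by the interaction sequence I (I !! t is the interaction I^(t+1)).\<close>
primrec traj :: "(real \<Rightarrow> real) \<Rightarrow> config \<Rightarrow> (nat \<times> nat) stream \<Rightarrow> nat \<Rightarrow> config" where
  "traj f U0 I 0 = U0"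
| "traj f U0 I (Suc t) = update f (I !! t) (traj f U0 I t)"

end

theory Submission
  imports Defs
begin

text \<open>Opinions only ever move towards \<open>\<plusminus>\<close> the influencing opinion, so what matters is the configuration
  of lines. Once signs can be chosen such that all signed opinions have pairwise inner products
  at least \<open>m > 0\<close>, this persists, the bound never decreases, and the word in which agent 0
  influences every other agent in turn shrinks \<open>1 - m\<close> by a fixed factor. That word occurs
  infinitely often almost surely, so the configuration polarizes.

  Such a choice of signs is reached almost surely because from every non-separable configuration
  some word of uniformly bounded length leads there. First pull all opinions within 60 degrees (as
  lines) of opinion 0 close to it; the remaining ones are within 30 degrees of the orthogonal line.
  For the two resulting clusters \<open>A\<close>, \<open>B\<close> take a pair \<open>(a, b)\<close> maximizing \<open>\<bar>\<langle>u\<^sub>a, u\<^sub>b\<rangle>\<bar> = \<Delta>\<close>, which is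
  positive by non-separability. The spread of each cluster is at most \<open>4 \<Delta>\<close>, so a number of pulls
  independent of \<open>\<Delta>\<close> brings \<open>A\<close> to \<open>a\<close> and \<open>B\<close> to \<open>b\<close> so tightly that all inner products between
  the clusters acquire the sign determined by \<open>\<langle>u\<^sub>a, u\<^sub>b\<rangle>\<close>.\<close>

section \<open>Random words\<close>

text \<open>Let \<open>q\<close> be the supremum over \<open>P\<close> of the probability of never hitting \<open>G\<close>. Conditioning on the
  word provided by \<open>reach\<close> gives \<open>q \<le> (1 - p ^ K) * q\<close>, where \<open>p > 0\<close> is the least weight of a
  letter, hence \<open>q = 0\<close>.\<close>
lemma AE_stream_hits:
  fixes D :: "'x::countable pmf" and step :: "'x \<Rightarrow> 's \<Rightarrow> 's"
  assumes fin: "finite (set_pmf D)"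
    and inv: "\<And>s x. s \<in> P \<Longrightarrow> x \<in> set_pmf D \<Longrightarrow> step x s \<in> P"
    and reach: "\<And>s. s \<in> P \<Longrightarrow>
      \<exists>w. length w \<le> K \<and> set w \<subseteq> set_pmf D \<and> fold step w s \<in> G"
    and "s \<in> P"
  shows "AE I in stream_space (measure_pmf D). \<exists>t. fold step (stake t I) s \<in> G"
proof -
  let ?S = "stream_space (measure_pmf D)"
  interpret S: prob_space ?S by (rule prob_space.prob_space_stream_space[OF prob_space_measure_pmf])
  have sets_S: "sets ?S = sets (stream_space (count_space UNIV))"
    by (rule sets_stream_space_cong) simp
  have space_S: "space ?S = UNIV"
    by (simp add: space_stream_space)
  define N where "N s = {I. \<forall>t. fold step (stake t I) s \<notin> G}" for s
  have meas: "N s \<in> sets ?S" for s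
  proof -
    have "{I \<in> space (stream_space (count_space UNIV)). \<forall>t. fold step (stake t I) s \<notin> G}
        \<in> sets (stream_space (count_space (UNIV :: 'x set)))"
      by measurable
    then show ?thesis
      unfolding sets_S N_def by (simp add: space_stream_space)
  qed
  define q where "q = (SUP s\<in>P. S.prob (N s))"
  have bdd: "bdd_above ((\<lambda>s. S.prob (N s)) ` P)"
    by (rule bdd_aboveI[of _ 1]) auto
  have le_q: "S.prob (N s) \<le> q" if "s \<in> P" for s
    unfolding q_def using that bdd by (rule cSUP_upper)
  have q0: "0 \<le> q"
    using le_q[OF \<open>s \<in> P\<close>] measure_nonneg[of ?S "N s"] by linarith
  define p where "p = Min (pmf D ` set_pmf D)"
  have ne: "set_pmf D \<noteq> {}" by (rule set_pmf_not_empty)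
  have p_le: "p \<le> pmf D x" if "x \<in> set_pmf D" for x
    unfolding p_def using fin that by simp
  have p0: "0 < p"
    unfolding p_def using fin ne by (auto simp: pmf_positive)
  have p1: "p \<le> 1"
    using p_le ne pmf_le_1 order_trans by fastforce
  have decay: "S.prob (N s) \<le> (1 - p ^ length w) * q"
    if "s \<in> P" "set w \<subseteq> set_pmf D" "fold step w s \<in> G" for s w
    using that
  proof (induction w arbitrary: s)
    case Nil
    then have "N s = {}" unfolding N_def by (auto intro!: exI[of _ 0])
    then show ?case by simp
  next
    case (Cons a w)
    define r where "r = p ^ length w"
    have r: "0 \<le> r" "r \<le> 1" unfolding r_def using p0 p1 by (auto intro: power_le_one)
    have IH: "S.prob (N (step a s)) \<le> (1 - r) * q"
      unfolding r_def using Cons inv by auto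
    \<comment> \<open>Bounds the probability of missing \<open>G\<close> given the first letter
      \<open>x\<close>: \<open>q\<close> in general, improved to \<open>(1 - r) * q\<close> for the
      letter \<open>a\<close> that starts the word.\<close>
    let ?h = "\<lambda>x. q - r * q * indicator {a} x"
    have h0: "0 \<le> ?h x" for x
      using r q0 by (auto simp: indicator_def mult_left_le_one_le)
    have "emeasure ?S (N s) = (\<integral>\<^sup>+x. emeasure ?S {I \<in> space ?S. x ## I \<in> N s} \<partial>D)"
      by (rule prob_space.emeasure_stream_space[OF prob_space_measure_pmf meas])
    also have "\<dots> \<le> (\<integral>\<^sup>+x. ennreal (?h x) \<partial>D)"
    proof (rule nn_integral_mono_AE, unfold AE_measure_pmf_iff, rule ballI)
      fix x assume x: "x \<in> set_pmf D"
      have "{I \<in> space ?S. x ## I \<in> N s} \<subseteq> N (step x s)"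
      proof
        fix I assume "I \<in> {I \<in> space ?S. x ## I \<in> N s}"
        then have "fold step (stake (Suc t) (x ## I)) s \<notin> G" for t unfolding N_def by blast
        then show "I \<in> N (step x s)" unfolding N_def by simp
      qed
      then have "emeasure ?S {I \<in> space ?S. x ## I \<in> N s} \<le> emeasure ?S (N (step x s))"
        by (rule emeasure_mono[OF _ meas])
      also have "\<dots> = ennreal (S.prob (N (step x s)))"
        by (rule S.emeasure_eq_measure)
      also have "\<dots> \<le> ennreal (?h x)"
        using IH le_q[OF inv[OF Cons.prems(1) x]]
        by (intro ennreal_leI) (auto simp: indicator_def algebra_simps)
      finally show "emeasure ?S {I \<in> space ?S. x ## I \<in> N s} \<le> ennreal (?h x)" .
    qed
    also have "\<dots> = ennreal (\<integral>x. ?h x \<partial>D)"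
      using h0 by (intro nn_integral_eq_integral integrable_measure_pmf_finite[OF fin]) auto
    also have "(\<integral>x. ?h x \<partial>D) = q - r * q * pmf D a"
      by (simp add: Bochner_Integration.integral_diff integrable_measure_pmf_finite[OF fin] measure_pmf_single)
    finally have "ennreal (S.prob (N s)) \<le> ennreal (q - r * q * pmf D a)"
      by (simp add: S.emeasure_eq_measure)
    \<comment> \<open>\<open>ennreal\<close> cuts negative reals off at 0, so the bound must be seen
      to be nonnegative before the inequality returns to the reals.\<close>
    moreover have "r * q * pmf D a \<le> q"
    proof -
      have "(r * pmf D a) * q \<le> 1 * q"
        using r q0 pmf_le_1[of D a] by (intro mult_right_mono mult_le_one) auto
      then show ?thesis by (simp add: mult_ac)
    qed
    ultimately have "S.prob (N s) \<le> q - r * q * pmf D a"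
      by (simp add: ennreal_le_iff)
    moreover have "r * q * p \<le> r * q * pmf D a"
      using r q0 p_le Cons.prems(2) by (intro mult_left_mono) auto
    ultimately show ?case
      by (simp add: r_def algebra_simps)
  qed
  have "S.prob (N s) \<le> (1 - p ^ K) * q" if "s \<in> P" for s
  proof -
    obtain w where w: "length w \<le> K" "set w \<subseteq> set_pmf D" "fold step w s \<in> G"
      using reach[OF \<open>s \<in> P\<close>] by blast
    \<comment> \<open>Since \<open>p \<le> 1\<close>, words shorter than \<open>K\<close> do at
      least as well, which makes the factor uniform in \<open>s\<close>.\<close>
    have "p ^ K \<le> p ^ length w"
      using w p0 p1 by (intro power_decreasing) auto
    then have "(1 - p ^ length w) * q \<le> (1 - p ^ K) * q"
      using q0 by (intro mult_right_mono) auto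
    then show ?thesis
      using decay[OF that w(2,3)] by linarith
  qed
  then have "q \<le> (1 - p ^ K) * q"
    unfolding q_def using \<open>s \<in> P\<close> by (intro cSUP_least) (auto simp: q_def)
  then have "p ^ K * q \<le> 0" by (simp add: algebra_simps)
  then have "q \<le> 0" using p0 using zero_less_power[OF p0, of K] by (auto simp: mult_le_0_iff)
  then have "S.prob (N s) = 0"
    using le_q[OF \<open>s \<in> P\<close>] measure_nonneg[of ?S "N s"] by linarith
  then have "AE I in ?S. I \<notin> N s"
    using meas by (intro AE_not_in) (auto simp: S.emeasure_eq_measure null_sets_def)
  then show ?thesis by (simp add: N_def)
qed

text \<open>The shift preserves the law of an i.i.d. stream: for any first letter, the section of
  the preimage of a null set \<open>N\<close> under \<open>stl\<close> lies in \<open>N\<close>.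
  Almost sure statements can thus be restarted at every time.\<close>

lemma AE_stream_sdrop:
  assumes "AE I in stream_space (measure_pmf D). Q I"
  shows "AE I in stream_space (measure_pmf D). Q (sdrop t I)"
proof (induction t)
  case (Suc t)
  let ?S = "stream_space (measure_pmf D)"
  interpret S: prob_space ?S by (rule prob_space.prob_space_stream_space[OF prob_space_measure_pmf])
  obtain N where N: "N \<in> sets ?S" "emeasure ?S N = 0" "{I \<in> space ?S. \<not> Q (sdrop t I)} \<subseteq> N"
    using Suc by (auto elim: AE_E)
  define N' where "N' = stl -` N \<inter> space ?S"
  have N': "N' \<in> sets ?S"
    unfolding N'_def using N(1) by (intro measurable_sets[of _ _ ?S]) auto
  have "emeasure ?S N' = (\<integral>\<^sup>+x. emeasure ?S {I \<in> space ?S. x ## I \<in> N'} \<partial>D)"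
    by (rule prob_space.emeasure_stream_space[OF prob_space_measure_pmf N'])
  also have "\<dots> = (\<integral>\<^sup>+x. 0 \<partial>D)"
  proof (rule nn_integral_cong)
    fix x
    have "emeasure ?S {I \<in> space ?S. x ## I \<in> N'} \<le> emeasure ?S N"
      using N(1) by (intro emeasure_mono) (auto simp: N'_def)
    then show "emeasure ?S {I \<in> space ?S. x ## I \<in> N'} = 0" using N(2) by simp
  qed
  finally have "emeasure ?S N' = 0" by simp
  then show ?case
    using N N' by (intro AE_I[of _ _ N']) (auto simp: N'_def space_stream_space)
qed (use assms in simp)

text \<open>\<open>AE_stream_hits\<close> is applied to the chain whose state is the reversed list
  of letters read so far: from every state, reading \<open>w\<close> produces a list starting with
  \<open>rev w\<close>. Restarting at each of the countably many times \<open>N\<close> gives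
  infinitely many occurrences.\<close>

lemma AE_stream_word_infinitely_often:
  fixes D :: "'x::countable pmf"
  assumes fin: "finite (set_pmf D)" and w: "set w \<subseteq> set_pmf D"
  shows "AE I in stream_space (measure_pmf D). \<forall>N. \<exists>t\<ge>N. stake (length w) (sdrop t I) = w"
proof -
  let ?S = "stream_space (measure_pmf D)"
  have fold_Cons: "fold (#) xs ys = rev xs @ ys" for xs ys :: "'x list"
    by (induction xs arbitrary: ys) auto
  have "AE I in ?S. \<exists>t. fold (#) (stake t I) [] \<in> {l. \<exists>l'. l = rev w @ l'}"
    by (rule AE_stream_hits[where P = UNIV and K = "length w"])
      (use fin w in \<open>auto simp: fold_Cons\<close>)
  then have *: "AE I in ?S. \<exists>t. stake (length w) (sdrop t I) = w"
  proof eventually_elim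
    case (elim I)
    then obtain t l' where "rev (stake t I) = rev w @ l'"
      by (auto simp: fold_Cons)
    \<comment> \<open>The hitting time \<open>t\<close> is the end of the occurrence of
      \<open>w\<close>; it begins at \<open>length l'\<close>.\<close>
    then have st: "stake t I = rev l' @ w"
      by (metis rev_append rev_rev_ident)
    then have "t = length l' + length w"
      by (metis length_append length_rev length_stake)
    then have "stake (length l') I @ stake (length w) (sdrop (length l') I) = rev l' @ w"
      using st by simp
    then show ?case by (metis append_eq_append_conv length_rev length_stake)
  qed
  have "AE I in ?S. \<forall>N. \<exists>t. stake (length w) (sdrop t (sdrop N I)) = w"
    using AE_stream_sdrop[OF *] by (simp add: AE_all_countable)
  then show ?thesis
    by eventually_elim (metis le_add1 sdrop_add)
qed

section \<open>A single interaction\<close>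

text \<open>\<open>sgn\<close> of a vector is its normalization. The new position depends on two
  opinions only, hence the separation from the configuration.\<close>

definition nudge :: "(real \<Rightarrow> real) \<Rightarrow> real ^ 2 \<Rightarrow> real ^ 2 \<Rightarrow> real ^ 2" where
  "nudge f u v = sgn (u + f (inner u v) *\<^sub>R v)"

lemma update_eq_nudge: "update f (i, j) U = U(i := nudge f (U i) (U j))"
  by (simp add: update_def nudge_def sgn_div_norm Let_def divide_inverse)

lemma abs_inner_le_1:
  fixes u v :: "'a::real_inner"
  shows "norm u = 1 \<Longrightarrow> norm v = 1 \<Longrightarrow> \<bar>inner u v\<bar> \<le> 1"
  using Cauchy_Schwarz_ineq2[of u v] by simp

lemma stable_sgn:
  assumes "stable f" "norm u = 1" "norm v = 1"
  shows "sgn (f (inner u v)) = sgn (inner u v)"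
  using assms abs_inner_le_1[of u v] unfolding stable_def by (auto simp: abs_le_iff)

lemma nudge_mult_pos:
  assumes "stable f" "norm u = 1" "norm v = 1"
  shows "0 \<le> inner u v * f (inner u v)"
  using stable_sgn[OF assms] by (auto simp: sgn_if zero_le_mult_iff split: if_splits)

lemma norm_add_scaleR_sq:
  fixes u v :: "'a::real_inner"
  assumes "norm u = 1" "norm v = 1"
  shows "(norm (u + g *\<^sub>R v))\<^sup>2 = 1 + 2 * (inner u v * g) + g\<^sup>2"
  using assms unfolding power2_norm_eq_inner
  by (simp add: norm_eq_1 inner_add_left inner_add_right inner_commute power2_eq_square algebra_simps)

text \<open>The cross term \<open>2 * (inner u v * f (inner u v))\<close> is nonnegative because
  \<open>f\<close> keeps signs. In particular the normalization never divides by 0.\<close>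

lemma nudge_norm_ge_1:
  assumes "stable f" "norm u = 1" "norm v = 1"
  shows "1 \<le> norm (u + f (inner u v) *\<^sub>R v)"
proof -
  have "1 \<le> (norm (u + f (inner u v) *\<^sub>R v))\<^sup>2"
    using norm_add_scaleR_sq[OF assms(2,3)] nudge_mult_pos[OF assms] by simp
  then show ?thesis using power2_le_imp_le[of 1 "norm (u + f (inner u v) *\<^sub>R v)"] by simp
qed

lemma nudgeE:
  assumes "stable f" "norm u = 1" "norm v = 1"
  obtains N where "1 \<le> N" "N \<le> 1 + \<bar>f (inner u v)\<bar>"
    "N\<^sup>2 = 1 + 2 * (inner u v * f (inner u v)) + (f (inner u v))\<^sup>2"
    "\<And>y. inner (nudge f u v) y = (inner u y + f (inner u v) * inner v y) / N"
    "nudge f u v = (1 / N) *\<^sub>R (u + f (inner u v) *\<^sub>R v)"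
proof
  show "1 \<le> norm (u + f (inner u v) *\<^sub>R v)" by (rule nudge_norm_ge_1[OF assms])
  show "norm (u + f (inner u v) *\<^sub>R v) \<le> 1 + \<bar>f (inner u v)\<bar>"
    using norm_triangle_ineq[of u "f (inner u v) *\<^sub>R v"] assms by simp
  show "(norm (u + f (inner u v) *\<^sub>R v))\<^sup>2 = 1 + 2 * (inner u v * f (inner u v)) + (f (inner u v))\<^sup>2"
    by (rule norm_add_scaleR_sq[OF assms(2,3)])
qed (simp_all add: nudge_def sgn_div_norm inner_add_left divide_inverse algebra_simps)

lemma norm_nudge:
  assumes "stable f" "norm u = 1" "norm v = 1"
  shows "norm (nudge f u v) = 1"
  using nudge_norm_ge_1[OF assms] unfolding nudge_def by (auto simp: norm_sgn)

lemma is_config_update: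
  assumes "stable f" "is_config n U" "x \<in> interactions n"
  shows "is_config n (update f x U)"
  using assms norm_nudge[OF assms(1)]
  by (auto simp: is_config_def opinion_def interactions_def update_eq_nudge)

lemma nudge_self:
  assumes "stable f" "norm u = 1"
  shows "nudge f u u = u"
proof -
  have u: "inner u u = 1" using assms by (simp add: norm_eq_1)
  have "f 1 > 0" using assms(1) unfolding stable_def by (auto simp: sgn_if dest: bspec[of _ _ 1] split: if_splits)
  moreover have "u + f 1 *\<^sub>R u = (1 + f 1) *\<^sub>R u" by (simp add: scaleR_add_left)
  ultimately show ?thesis using assms(2) unfolding nudge_def u by (simp add: sgn_scaleR sgn_div_norm)
qed

text \<open>By compactness \<open>\<bar>f\<bar>\<close> attains its minimum away from 0, where it
  has no zero. For \<open>m > 1\<close> the range is empty and any constant serves.\<close>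

lemma stable_bounded_away:
  assumes "stable f" "0 < m"
  obtains c where "0 < c" "\<And>A. m \<le> \<bar>A\<bar> \<Longrightarrow> \<bar>A\<bar> \<le> 1 \<Longrightarrow> c \<le> \<bar>f A\<bar>"
proof -
  let ?K = "{-1..-m} \<union> {m..1}"
  have "compact ?K" by (intro compact_Un) auto
  have "continuous_on ?K (\<lambda>A. \<bar>f A\<bar>)"
    using assms unfolding stable_def
    by (intro continuous_on_rabs) (auto intro: continuous_on_subset)
  show ?thesis
  proof (cases "?K = {}")
    case True
    then have "\<And>A. m \<le> \<bar>A\<bar> \<Longrightarrow> \<bar>A\<bar> \<le> 1 \<Longrightarrow> False" by (auto simp: abs_le_iff)
    then show ?thesis by (intro that[of 1]) auto
  next
    case False
    obtain A0 where A0: "A0 \<in> ?K" "\<And>A. A \<in> ?K \<Longrightarrow> \<bar>f A0\<bar> \<le> \<bar>f A\<bar>"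
      using continuous_attains_inf[OF \<open>compact ?K\<close> False \<open>continuous_on ?K (\<lambda>A. \<bar>f A\<bar>)\<close>] by blast
    have "A0 \<in> {-1..1}" "A0 \<noteq> 0" using A0(1) assms(2) by auto
    then have "f A0 \<noteq> 0"
      using assms(1) unfolding stable_def by (metis sgn_0 sgn_eq_0_iff)
    moreover have "A \<in> ?K" if "m \<le> \<bar>A\<bar>" "\<bar>A\<bar> \<le> 1" for A
      using that by (auto simp: abs_if split: if_splits)
    ultimately show ?thesis using A0(2) by (intro that[of "\<bar>f A0\<bar>"]) auto
  qed
qed

section \<open>Preservation of non-separability\<close>

lemma separableE:
  assumes "separable n U" "i < n"
  obtains S T where "S \<noteq> {}" "T \<noteq> {}" "S \<inter> T = {}" "S \<union> T = {..<n}" "i \<in> S"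
    "\<And>k l. k \<in> S \<Longrightarrow> l \<in> T \<Longrightarrow> inner (U k) (U l) = 0"
proof -
  from assms(1) obtain S T where ST: "S \<noteq> {} \<and> T \<noteq> {} \<and> S \<inter> T = {} \<and> S \<union> T = {..<n} \<and>
      (\<forall>k\<in>S. \<forall>l\<in>T. inner (U k) (U l) = 0)"
    unfolding separable_def by (elim exE)
  then have "i \<in> S \<or> i \<in> T" using \<open>i < n\<close> by auto
  then show ?thesis
  proof
    assume "i \<in> S"
    then show ?thesis by (intro that[of S T]) (use ST in simp_all)
  next
    assume "i \<in> T"
    have "inner (U l) (U k) = 0" if "k \<in> S" "l \<in> T" for k l
      using ST that by (simp add: inner_commute)
    then show ?thesis
      using \<open>i \<in> T\<close> by (intro that[of T S]) (use ST in \<open>simp_all add: Un_commute Int_commute\<close>)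
  qed
qed

text \<open>A partition that separates the updated configuration also separates the old one. Only
  products with the moved agent \<open>i\<close> need an argument, by the side on which the
  influencer \<open>j\<close> lies.\<close>

lemma not_separable_update:
  assumes f: "stable f" and U: "is_config n U" and x: "x \<in> interactions n"
    and nsep: "\<not> separable n U"
  shows "\<not> separable n (update f x U)"
proof
  assume "separable n (update f x U)"
  obtain i j where [simp]: "x = (i, j)" and ij: "i < n" "j < n" "i \<noteq> j"
    using x by (auto simp: interactions_def)
  let ?V = "update f (i, j) U"
  have nrm: "norm (U i) = 1" "norm (U j) = 1"
    using U ij by (auto simp: is_config_def opinion_def)
  have V: "?V i = nudge f (U i) (U j)" "\<And>k. k \<noteq> i \<Longrightarrow> ?V k = U k"
    by (auto simp: update_eq_nudge)
  obtain N where N: "1 \<le> N"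
    "\<And>y. inner (nudge f (U i) (U j)) y = (inner (U i) y + f (inner (U i) (U j)) * inner (U j) y) / N"
    by (rule nudgeE[OF f nrm]) (rule that)
  obtain S T where ST: "S \<noteq> {}" "T \<noteq> {}" "S \<inter> T = {}" "S \<union> T = {..<n}" "i \<in> S"
    "\<And>k l. k \<in> S \<Longrightarrow> l \<in> T \<Longrightarrow> inner (?V k) (?V l) = 0"
    by (rule separableE[OF \<open>separable n (update f x U)\<close>[unfolded \<open>x = (i, j)\<close>] \<open>i < n\<close>]) (rule that)
  have iT: "i \<notin> T" using ST by auto
  have "inner (U k) (U l) = 0" if "k \<in> S" "l \<in> T" for k l
  proof (cases "k = i")
    case False
    then show ?thesis using ST(6)[OF that] V(2) iT that by metis
  next
    case True
    have l: "?V l = U l" using V(2) iT that by metis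
    have *: "inner (U i) (U l) + f (inner (U i) (U j)) * inner (U j) (U l) = 0"
      using ST(6)[OF that] N unfolding True V(1) l by simp
    have "j \<in> S \<or> j \<in> T" using ST(4) ij by auto
    then show ?thesis
    proof
      assume "j \<in> S"
      then have "inner (U j) (U l) = 0" using ST(6)[OF _ that(2)] V(2) l ij by metis
      then show ?thesis using * True by simp
    next
      \<comment> \<open>Orthogonality of the new opinion to \<open>U j\<close> says that
        \<open>inner (U i) (U j)\<close> and its image under \<open>f\<close> sum to 0. They have
        the same sign, so both vanish and the interaction did not move \<open>i\<close>.\<close>
      assume "j \<in> T"
      then have "inner (?V i) (U j) = 0" using ST(6)[OF \<open>i \<in> S\<close>] V(2) ij by metis
      then have "inner (U i) (U j) + f (inner (U i) (U j)) = 0"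
        using N nrm unfolding V(1) by (simp add: norm_eq_1)
      then have "inner (U i) (U j) = 0"
        using stable_sgn[OF f nrm] by (auto simp: sgn_if split: if_splits)
      moreover from this have "f (inner (U i) (U j)) = 0"
        using stable_sgn[OF f nrm] by (simp add: sgn_eq_0_iff)
      ultimately show ?thesis using * True by simp
    qed
  qed
  then have "separable n U"
    unfolding separable_def using ST(1-4) by (intro exI[of _ S] exI[of _ T]) simp
  with nsep show False ..
qed

section \<open>Words of interactions\<close>

lemma fold_update_invariant:
  assumes "stable f" "is_config n U" "\<not> separable n U" "set w \<subseteq> interactions n"
  shows "is_config n (fold (update f) w U)" "\<not> separable n (fold (update f) w U)"
proof -
  have "is_config n (fold (update f) w U) \<and> \<not> separable n (fold (update f) w U)"
    using assms by (induction w arbitrary: U) (auto simp: is_config_update not_separable_update)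
  then show "is_config n (fold (update f) w U)" "\<not> separable n (fold (update f) w U)" by auto
qed

text \<open>The influencer \<open>j\<close> stays fixed and each listed agent moves once, so the
  successive updates act like one simultaneous update.\<close>

lemma fold_update_sweep:
  assumes "distinct xs" "j \<notin> set xs"
  shows "fold (update f) (map (\<lambda>i. (i, j)) xs) U =
    (\<lambda>i. if i \<in> set xs then nudge f (U i) (U j) else U i)"
  using assms by (induction xs arbitrary: U) (auto simp: update_eq_nudge fun_eq_iff)

lemma traj_eq_fold: "traj f U I t = fold (update f) (stake t I) U"
  by (induction t) (simp_all add: stake_Suc del: stake.simps(2))

lemma traj_add: "traj f U I (t + k) = fold (update f) (stake k (sdrop t I)) (traj f U I t)"
  by (simp add: traj_eq_fold stake_add[symmetric] del: stake_add)

section \<open>Contraction of coherent configurations\<close>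

text \<open>The signed new opinion is \<open>(\<sigma> u + g \<tau> v) / N\<close> with
  \<open>g \<ge> 0\<close> and \<open>N \<le> 1 + g\<close>. Its product with \<open>y\<close> is
  therefore at least the mean of \<alpha> and \<beta> with weight \<open>g / (1 + g)\<close> on
  \<beta>, and this weight increases with \<open>g\<close>.\<close>

lemma nudge_lower:
  assumes f: "stable f" and nrm: "norm u = 1" "norm v = 1"
    and sg: "\<sigma> = 1 \<or> \<sigma> = -1" "\<tau> = 1 \<or> \<tau> = -1" and pos: "0 < \<sigma> * \<tau> * inner u v"
    and ab: "0 \<le> \<alpha>" "\<alpha> \<le> \<beta>" "\<alpha> \<le> \<sigma> * inner u y" "\<beta> \<le> \<tau> * inner v y"
    and c: "0 \<le> c" "c \<le> \<bar>f (inner u v)\<bar>"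
  shows "\<alpha> + (\<beta> - \<alpha>) * (c / (1 + c)) \<le> \<sigma> * inner (nudge f u v) y"
proof -
  define g where "g = \<bar>f (inner u v)\<bar>"
  have g: "f (inner u v) = \<sigma> * \<tau> * g" "0 \<le> g"
    using stable_sgn[OF f nrm] sg pos unfolding g_def by (auto simp: sgn_if abs_if split: if_splits)
  obtain N where N: "1 \<le> N" "N \<le> 1 + g"
    "\<And>y. inner (nudge f u v) y = (inner u y + f (inner u v) * inner v y) / N"
    by (rule nudgeE[OF f nrm, folded g_def]) (rule that)
  have "c / (1 + c) \<le> g / (1 + g)"
    using c g(2) unfolding g_def by (simp add: field_simps)
  then have "\<alpha> + (\<beta> - \<alpha>) * (c / (1 + c)) \<le> \<alpha> + (\<beta> - \<alpha>) * (g / (1 + g))"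
    using ab by (intro add_left_mono mult_left_mono) auto
  also have "\<dots> = (\<alpha> + g * \<beta>) / (1 + g)"
    using g by (simp add: field_simps)
  also have "\<dots> \<le> (\<alpha> + g * \<beta>) / N"
    using N g ab by (intro divide_left_mono) auto
  also have "\<dots> \<le> (\<sigma> * inner u y + g * (\<tau> * inner v y)) / N"
    using N g ab by (intro divide_right_mono add_mono mult_left_mono) auto
  also have "\<dots> = \<sigma> * inner (nudge f u v) y"
    using sg unfolding N(3) g(1) by auto
  finally show ?thesis .
qed

text \<open>The signs are an explicit argument because they stay fixed along a trajectory while
  \<open>m\<close> improves.\<close>

definition coherent :: "nat \<Rightarrow> (nat \<Rightarrow> real) \<Rightarrow> real \<Rightarrow> config \<Rightarrow> bool" where
  "coherent n s m U \<longleftrightarrow> (\<forall>k<n. \<forall>l<n. m \<le> s k * s l * inner (U k) (U l))"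

text \<open>The case \<alpha> = \<beta> = \<open>r\<close>, \<open>c = 0\<close> of
  \<open>nudge_lower\<close>: a new signed opinion is a nonnegative combination, of total weight at
  least 1, of two old ones.\<close>

lemma update_lower:
  assumes f: "stable f" and U: "is_config n U" and x: "x \<in> interactions n"
    and s: "\<And>k. s k = 1 \<or> s k = -1" and co: "coherent n s m U" "0 < m"
    and y: "\<And>k. k < n \<Longrightarrow> r \<le> s k * inner (U k) y" "0 \<le> r" and "k < n"
  shows "r \<le> s k * inner (update f x U k) y"
proof -
  obtain i j where x: "x = (i, j)" "i < n" "j < n"
    using x by (auto simp: interactions_def)
  have "0 < s i * s j * inner (U i) (U j)"
    using co x unfolding coherent_def by fastforce
  then have "r + (r - r) * (0 / (1 + 0)) \<le> s i * inner (nudge f (U i) (U j)) y"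
    using U x y by (intro nudge_lower[OF f _ _ s s]) (auto simp: is_config_def opinion_def)
  then show ?thesis
    using y \<open>k < n\<close> by (simp add: x update_eq_nudge)
qed

lemma coherent_update:
  assumes f: "stable f" and U: "is_config n U" and x: "x \<in> interactions n"
    and s: "\<And>k. s k = 1 \<or> s k = -1" and co: "coherent n s m U" "0 < m"
  shows "coherent n s m (update f x U)"
proof -
  let ?V = "update f x U"
  \<comment> \<open>The two arguments are replaced one at a time: \<open>y\<close> is first an old
    signed opinion, then an updated one.\<close>
  have *: "m \<le> s l * inner (U l) (s k *\<^sub>R ?V k)" if "k < n" "l < n" for k l
  proof -
    have "m \<le> s k * inner (?V k) (s l *\<^sub>R U l)"
      using co that
      by (intro update_lower[OF f U x s co]) (auto simp: coherent_def mult_ac)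
    then show ?thesis by (simp add: inner_commute mult_ac)
  qed
  have "m \<le> s l * inner (?V l) (s k *\<^sub>R ?V k)" if "k < n" "l < n" for k l
    using co that * by (intro update_lower[OF f U x s co]) auto
  then have "m \<le> s k * s l * inner (?V k) (?V l)" if "k < n" "l < n" for k l
    using that by (simp add: inner_commute[of "?V k" "?V l"] mult_ac)
  then show ?thesis by (simp add: coherent_def)
qed

lemma coherent_le_1:
  assumes "is_config n U" "coherent n s m U" "0 < n" "\<And>k. s k = 1 \<or> s k = -1"
  shows "m \<le> 1"
proof -
  have "m \<le> s 0 * s 0 * inner (U 0) (U 0)" using assms unfolding coherent_def by blast
  also have "\<dots> = 1"
    using assms(4)[of 0] assms(1,3) by (auto simp: is_config_def opinion_def norm_eq_1)
  finally show ?thesis .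
qed

text \<open>Agent 0 has product 1 with itself, so moving towards it gains a fraction
  \<open>q\<close> of \<open>1 - m\<close> against agent 0. Moving the other argument as well turns
  this into a gain of \<open>q\<^sup>2\<close> between any two agents.\<close>

lemma coherent_sweep:
  assumes f: "stable f" and U: "is_config n U" and "0 < n"
    and s: "\<And>k. s k = 1 \<or> s k = -1" and co: "coherent n s m U" "0 < m"
    and c: "0 \<le> c" "\<And>A. m \<le> \<bar>A\<bar> \<Longrightarrow> \<bar>A\<bar> \<le> 1 \<Longrightarrow> c \<le> \<bar>f A\<bar>"
  shows "coherent n s (m + (1 - m) * (c / (1 + c))\<^sup>2)
    (fold (update f) (map (\<lambda>i. (i, 0)) [1..<n]) U)"
proof -
  let ?V = "fold (update f) (map (\<lambda>i. (i, 0)) [1..<n]) U"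
  define q where "q = c / (1 + c)"
  have q: "0 \<le> q" using c by (simp add: q_def)
  have nrm: "norm (U k) = 1" if "k < n" for k
    using U that by (auto simp: is_config_def opinion_def)
  have m1: "m \<le> 1" using coherent_le_1[OF U co(1) \<open>0 < n\<close> s] .
  \<comment> \<open>Agent 0 is not in the sweep, but \<open>nudge_self\<close> lets the same formula
    cover it.\<close>
  have V: "?V k = nudge f (U k) (U 0)" if "k < n" for k
    using that nudge_self[OF f nrm[OF \<open>0 < n\<close>]] \<open>0 < n\<close>
    by (subst fold_update_sweep) (auto simp: Suc_le_eq)
  have co': "m \<le> s k * s l * inner (U k) (U l)" if "k < n" "l < n" for k l
    using co that by (auto simp: coherent_def)
  have cb: "c \<le> \<bar>f (inner (U k) (U 0))\<bar>" if "k < n" for k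
  proof (rule c(2))
    show "m \<le> \<bar>inner (U k) (U 0)\<bar>"
      using co'[OF that \<open>0 < n\<close>] s[of k] s[of 0] by auto
  qed (intro abs_inner_le_1 nrm that \<open>0 < n\<close>)
  have step: "\<alpha> + (\<beta> - \<alpha>) * q \<le> s k * inner (?V k) y"
    if "k < n" "0 \<le> \<alpha>" "\<alpha> \<le> \<beta>" "\<alpha> \<le> s k * inner (U k) y" "\<beta> \<le> s 0 * inner (U 0) y" for k \<alpha> \<beta> y
    unfolding V[OF \<open>k < n\<close>] q_def
    using co'[OF \<open>k < n\<close> \<open>0 < n\<close>] co(2) that \<open>0 < n\<close> nrm c(1) cb s
    by (intro nudge_lower[OF f, where \<tau> = "s 0"]) auto
  have "m + (1 - m) * q\<^sup>2 \<le> s k * s l * inner (?V k) (?V l)" if kl: "k < n" "l < n" for k l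
  proof -
    \<comment> \<open>Here \<alpha> = \<beta>: no gain is claimed, only that the old bound
      survives.\<close>
    have "m + (m - m) * q \<le> s l * inner (?V l) (s k *\<^sub>R U k)"
      using co'[of l k] co'[of l 0] co'[of 0 k] kl \<open>0 < n\<close> co(2) by (intro step) (auto simp: mult_ac)
    then have a: "m \<le> s k * inner (U k) (s l *\<^sub>R ?V l)"
      by (simp add: inner_commute mult_ac)
    \<comment> \<open>First gain, with \<beta> = 1 from agent 0 against itself.\<close>
    have "m + (1 - m) * q \<le> s l * inner (?V l) (s 0 *\<^sub>R U 0)"
      using co'[of l 0] kl \<open>0 < n\<close> co(2) m1 s[of 0] nrm[of 0]
      by (intro step) (auto simp: mult_ac norm_eq_1)
    then have b: "m + (1 - m) * q \<le> s 0 * inner (U 0) (s l *\<^sub>R ?V l)"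
      by (simp add: inner_commute mult_ac)
    \<comment> \<open>Second gain: the bound just obtained against agent 0 now serves as
      \<beta>.\<close>
    have "m + (m + (1 - m) * q - m) * q \<le> s k * inner (?V k) (s l *\<^sub>R ?V l)"
      using a b kl co(2) m1 q by (intro step) auto
    then show ?thesis by (simp add: power2_eq_square mult_ac)
  qed
  then show ?thesis by (simp add: coherent_def q_def)
qed

lemma is_config_traj:
  assumes "stable f" "is_config n U0" "\<And>t. I !! t \<in> interactions n"
  shows "is_config n (traj f U0 I t)"
  by (induction t) (simp_all add: assms is_config_update)

lemma traj_lower:
  assumes f: "stable f" and U: "is_config n U0" and I: "\<And>t. I !! t \<in> interactions n"
    and s: "\<And>k. s k = 1 \<or> s k = -1" and co: "coherent n s m (traj f U0 I t0)" "0 < m"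
    and y: "\<And>k. k < n \<Longrightarrow> r \<le> s k * inner (traj f U0 I t0 k) y" "0 \<le> r" and "t0 \<le> t"
  shows "coherent n s m (traj f U0 I t)" "\<And>k. k < n \<Longrightarrow> r \<le> s k * inner (traj f U0 I t k) y"
proof -
  have "coherent n s m (traj f U0 I t) \<and> (\<forall>k<n. r \<le> s k * inner (traj f U0 I t k) y)"
    using \<open>t0 \<le> t\<close>
  proof (induction t rule: dec_induct)
    case base
    then show ?case using co y by auto
  next
    case (step t)
    note V = is_config_traj[OF f U I, of t]
    show ?case
      using step.IH coherent_update[OF f V I, of s, OF s _ co(2)]
        update_lower[OF f V I, of s, OF s _ co(2) _ y(2)]
      by auto
  qed
  then show "coherent n s m (traj f U0 I t)" "\<And>k. k < n \<Longrightarrow> r \<le> s k * inner (traj f U0 I t k) y"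
    by auto
qed

text \<open>Each occurrence of the sweep multiplies the deficit \<open>1 - m\<close> by at most
  \<rho>, and nothing is lost between occurrences.\<close>

lemma traj_coherent_tendsto_1:
  assumes f: "stable f" and U: "is_config n U0" and I: "\<And>t. I !! t \<in> interactions n"
    and "0 < n"
    and s: "\<And>k. s k = 1 \<or> s k = -1" and co: "coherent n s m (traj f U0 I t0)" "0 < m"
    and io: "\<And>N. \<exists>t\<ge>N. stake (n - 1) (sdrop t I) = map (\<lambda>i. (i, 0)) [1..<n]"
    and "\<epsilon> > 0"
  shows "\<exists>T. coherent n s (1 - \<epsilon>) (traj f U0 I T)"
proof -
  obtain c where c: "0 < c" "\<And>A. m \<le> \<bar>A\<bar> \<Longrightarrow> \<bar>A\<bar> \<le> 1 \<Longrightarrow> c \<le> \<bar>f A\<bar>"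
    by (rule stable_bounded_away[OF f co(2)]) (rule that)
  define \<rho> where "\<rho> = 1 - (c / (1 + c))\<^sup>2"
  have "c / (1 + c) > 0" "c / (1 + c) < 1" using c(1) by auto
  then have "0 < (c / (1 + c))\<^sup>2" "(c / (1 + c))\<^sup>2 < 1"
    by (auto simp: power_less_one_iff)
  then have \<rho>: "0 < \<rho>" "\<rho> < 1" by (auto simp: \<rho>_def)
  have cfg: "is_config n (traj f U0 I t)" for t by (rule is_config_traj[OF f U I])
  have m1: "m \<le> 1" by (rule coherent_le_1[OF cfg co(1) \<open>0 < n\<close> s])
  have "\<exists>T. coherent n s (1 - (1 - m) * \<rho> ^ r) (traj f U0 I T)" for r
  proof (induction r)
    case 0
    then show ?case using co by auto
  next
    case (Suc r)
    define M where "M = 1 - (1 - m) * \<rho> ^ r"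
    obtain T where T: "coherent n s M (traj f U0 I T)" using Suc unfolding M_def by blast
    have "(1 - m) * \<rho> ^ r \<le> (1 - m) * 1"
      using m1 \<rho> by (intro mult_left_mono power_le_one) auto
    \<comment> \<open>The bound has only grown, so the constant \<open>c\<close> chosen for
      \<open>m\<close> is still valid for \<open>M\<close>.\<close>
    then have M: "m \<le> M" unfolding M_def by simp
    obtain t where t: "t \<ge> T" "stake (n - 1) (sdrop t I) = map (\<lambda>i. (i, 0)) [1..<n]"
      using io by blast
    have "coherent n s M (traj f U0 I t)"
      by (rule traj_lower(1)[OF f U I s T, where y = 0 and r = 0]) (use M co(2) t in auto)
    then have "coherent n s (M + (1 - M) * (c / (1 + c))\<^sup>2) (traj f U0 I (t + (n - 1)))"
      unfolding traj_add t(2) using M co(2) c \<open>0 < n\<close>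
      by (intro coherent_sweep[OF f cfg _ s]) auto
    moreover have "M + (1 - M) * (c / (1 + c))\<^sup>2 = 1 - (1 - m) * \<rho> ^ Suc r"
      unfolding M_def \<rho>_def by (simp add: algebra_simps)
    ultimately show ?case by auto
  qed
  moreover obtain r where "\<rho> ^ r < \<epsilon>" using real_arch_pow_inv[OF \<open>\<epsilon> > 0\<close> \<rho>(2)] by blast
  moreover have "(1 - m) * \<rho> ^ r \<le> 1 * \<rho> ^ r" for r
    using co(2) \<rho> by (intro mult_right_mono) auto
  ultimately obtain T r where "coherent n s (1 - (1 - m) * \<rho> ^ r) (traj f U0 I T)" "(1 - m) * \<rho> ^ r \<le> \<epsilon>"
    by (metis less_eq_real_def mult_1 order_trans)
  then show ?thesis unfolding coherent_def by (meson diff_left_mono order_trans)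
qed

text \<open>Coherence close to 1 at a time \<open>T\<close> confines all later signed opinions to a
  small ball around the signed opinion of agent 0 at time \<open>T\<close>. This yields the Cauchy
  property and a common limit up to sign.\<close>

lemma polarizes_if_coherent:
  assumes f: "stable f" and U: "is_config n U0" and I: "\<And>t. I !! t \<in> interactions n"
    and "0 < n"
    and s: "\<And>k. s k = 1 \<or> s k = -1" and co: "coherent n s m (traj f U0 I t0)" "0 < m"
    and io: "\<And>N. \<exists>t\<ge>N. stake (n - 1) (sdrop t I) = map (\<lambda>i. (i, 0)) [1..<n]"
  shows "polarizes n (traj f U0 I)"
proof -
  let ?v = "\<lambda>t k. s k *\<^sub>R traj f U0 I t k"
  have cfg: "is_config n (traj f U0 I t)" for t by (rule is_config_traj[OF f U I])
  have nrm: "norm (?v t k) = 1" if "k < n" for t k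
    using cfg[of t] s[of k] that by (auto simp: is_config_def opinion_def)
  have ss: "s k * s k = 1" for k using s[of k] by auto
  have close: "\<exists>T. \<forall>t\<ge>T. \<forall>k<n. dist (?v t k) (?v T 0) < \<epsilon>" if "\<epsilon> > 0" for \<epsilon>
  proof -
    \<comment> \<open>Unit vectors with product at least 1 - \<delta> have squared distance at most
      2 \<delta>. The cap 1/2 keeps 1 - \<delta> positive for \<open>traj_lower\<close>.\<close>
    define \<delta> where "\<delta> = min (1/2) (\<epsilon>\<^sup>2 / 4)"
    have \<delta>: "0 < \<delta>" "\<delta> < 1" "2 * \<delta> < \<epsilon>\<^sup>2" using that by (auto simp: \<delta>_def min_def)
    obtain T where T: "coherent n s (1 - \<delta>) (traj f U0 I T)"
      using traj_coherent_tendsto_1[OF f U I \<open>0 < n\<close> s co io \<delta>(1)] by auto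
    have "dist (?v t k) (?v T 0) < \<epsilon>" if "T \<le> t" "k < n" for t k
    proof -
      have "1 - \<delta> \<le> s k * inner (traj f U0 I t k) (?v T 0)"
        using T \<delta> \<open>0 < n\<close>
        by (intro traj_lower(2)[OF f U I s T _ _ _ \<open>T \<le> t\<close> \<open>k < n\<close>]) (auto simp: coherent_def mult_ac)
      then have "1 - \<delta> \<le> inner (?v t k) (?v T 0)" by (simp add: mult_ac)
      moreover have "(dist (?v t k) (?v T 0))\<^sup>2 = 2 - 2 * inner (?v t k) (?v T 0)"
        using nrm[OF \<open>k < n\<close>, of t] nrm[OF \<open>0 < n\<close>, of T]
        unfolding dist_norm power2_norm_eq_inner norm_eq_1 inner_diff_left inner_diff_right
        by (simp add: inner_commute)
      ultimately have "(dist (?v t k) (?v T 0))\<^sup>2 < \<epsilon>\<^sup>2" using \<delta>(3) by linarith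
      then show ?thesis using \<open>\<epsilon> > 0\<close> by (simp add: power_less_imp_less_base)
    qed
    then show ?thesis by blast
  qed
  have "Cauchy (\<lambda>t. ?v t 0)"
    unfolding Cauchy_altdef2 using close \<open>0 < n\<close> by blast
  then obtain a where a: "(\<lambda>t. ?v t 0) \<longlonglongrightarrow> a"
    using Cauchy_convergent convergent_def by blast
  have lim: "(\<lambda>t. ?v t k) \<longlonglongrightarrow> a" if "k < n" for k
  proof (rule metric_LIMSEQ_I)
    fix \<epsilon> :: real assume "0 < \<epsilon>"
    then obtain T where T: "\<And>t k. t \<ge> T \<Longrightarrow> k < n \<Longrightarrow> dist (?v t k) (?v T 0) < \<epsilon> / 3"
      using close[of "\<epsilon> / 3"] by auto
    obtain T' where T': "\<And>t. t \<ge> T' \<Longrightarrow> dist (?v t 0) a < \<epsilon> / 3"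
      using metric_LIMSEQ_D[OF a, of "\<epsilon> / 3"] \<open>0 < \<epsilon>\<close> by auto
    have "dist (?v t k) a < \<epsilon>" if "t \<ge> max T T'" for t
      using T[of t k] T[of t 0] T'[of t] that \<open>k < n\<close> \<open>0 < n\<close>
        dist_triangle[of "?v t k" a "?v T 0"] dist_triangle3[of "?v T 0" a "?v t 0"] by simp
    then show "\<exists>no. \<forall>t\<ge>no. dist (?v t k) a < \<epsilon>" by blast
  qed
  have "(\<lambda>t. traj f U0 I t k) \<longlonglongrightarrow> s k *\<^sub>R a" if "k < n" for k
    using tendsto_scaleR[OF tendsto_const[of "s k"] lim[OF that]] by (simp add: ss)
  moreover have "polarized n (\<lambda>k. s k *\<^sub>R a)"
    unfolding polarized_def
  proof (intro allI impI)
    fix k l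
    show "s k *\<^sub>R a = s l *\<^sub>R a \<or> s k *\<^sub>R a = - (s l *\<^sub>R a)"
      using s[of k] s[of l] by auto
  qed
  ultimately show ?thesis
    unfolding polarizes_def by (intro exI[of _ "\<lambda>k. s k *\<^sub>R a"]) auto
qed

section \<open>Reaching a coherent configuration in the plane\<close>

text \<open>The determinant; for unit vectors the sine of the oriented angle from \<open>u\<close>
  to \<open>v\<close>, whose cosine is \<open>inner u v\<close>.\<close>

definition cross2 :: "real ^ 2 \<Rightarrow> real ^ 2 \<Rightarrow> real" where
  "cross2 u v = u $ 1 * v $ 2 - u $ 2 * v $ 1"

text \<open>Up to sign, the tangent of the angle between \<open>u\<close> and \<open>v\<close>; a junk 0 if they are orthogonal.\<close>
definition slope :: "real ^ 2 \<Rightarrow> real ^ 2 \<Rightarrow> real" where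
  "slope u v = cross2 u v / inner u v"

lemma inner_real2: "inner u v = u $ 1 * v $ 1 + u $ 2 * v $ (2 :: 2)" for u v :: "real ^ 2"
  by (simp add: inner_vec_def UNIV_2)

lemma inner_sq_plus_cross2_sq:
  assumes "norm u = 1" "norm v = 1"
  shows "(inner u v)\<^sup>2 + (cross2 u v)\<^sup>2 = 1"
proof -
  have "(inner u v)\<^sup>2 + (cross2 u v)\<^sup>2 = inner u u * inner v v"
    by (simp add: inner_real2 cross2_def power2_eq_square algebra_simps)
  then show ?thesis using assms by (simp add: norm_eq_1)
qed

lemma abs_cross2_le_1:
  assumes "norm u = 1" "norm v = 1"
  shows "\<bar>cross2 u v\<bar> \<le> 1"
proof -
  have "(cross2 u v)\<^sup>2 \<le> 1"
    using inner_sq_plus_cross2_sq[OF assms] zero_le_power2[of "inner u v"] by linarith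
  then show ?thesis by (simp add: abs_square_le_1)
qed

text \<open>Expansion in the orthonormal frame of \<open>e\<close> and its quarter turn, i.e. the
  cosine of a difference of angles; \<open>cross2_frame\<close> is the sine.\<close>

lemma inner_frame:
  assumes "norm e = 1"
  shows "inner u w = inner u e * inner w e + cross2 u e * cross2 w e"
proof -
  have "inner u w * inner e e = inner u e * inner w e + cross2 u e * cross2 w e"
    by (simp add: inner_real2 cross2_def algebra_simps)
  then show ?thesis using assms by (simp add: norm_eq_1)
qed

lemma cross2_frame:
  assumes "norm e = 1"
  shows "cross2 u w = cross2 u e * inner w e - cross2 w e * inner u e"
proof -
  have "cross2 u w * inner e e = cross2 u e * inner w e - cross2 w e * inner u e"
    by (simp add: inner_real2 cross2_def algebra_simps)
  then show ?thesis using assms by (simp add: norm_eq_1)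
qed

lemma cross2_slope: "inner u e \<noteq> 0 \<Longrightarrow> cross2 u e = slope u e * inner u e"
  by (simp add: slope_def)

lemma inner_slopes:
  assumes "norm e = 1" "inner u e \<noteq> 0" "inner w e \<noteq> 0"
  shows "inner u w = inner u e * inner w e * (1 + slope u e * slope w e)"
  using inner_frame[OF assms(1), of u w] by (simp add: cross2_slope assms algebra_simps)

text \<open>Two reference directions are needed for opinions in different clusters: for small slopes
  the factor in parentheses is a perturbation of \<open>inner e h\<close>.\<close>

lemma inner_slopes2:
  assumes "norm e = 1" "norm h = 1" "inner u e \<noteq> 0" "inner w h \<noteq> 0"
  shows "inner u w = inner u e * inner w h *
    (inner e h * (1 + slope u e * slope w h) + cross2 e h * (slope w h - slope u e))"
proof -
  have "cross2 h e = - cross2 e h" by (simp add: cross2_def)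
  then have uh: "inner u h = inner u e * (inner e h - slope u e * cross2 e h)"
      "cross2 u h = inner u e * (slope u e * inner e h + cross2 e h)"
    using inner_frame[OF assms(1), of u h] cross2_frame[OF assms(1), of u h]
    by (simp_all add: cross2_slope assms inner_commute[of h e] algebra_simps)
  show ?thesis
    unfolding inner_frame[OF assms(2), of u w] cross2_slope[OF assms(4)] uh
    by (simp add: algebra_simps)
qed

lemma slope_self: "slope u u = 0"
  by (simp add: slope_def cross2_def)

text \<open>Adding a multiple of \<open>v\<close> leaves \<open>cross2 u v\<close> unchanged and
  increases \<open>\<bar>inner u v\<bar>\<close> by a factor of at least \<open>1 + c\<close>; the
  normalization cancels in the quotient.\<close>

lemma nudge_slope:
  assumes f: "stable f" and nrm: "norm u = 1" "norm v = 1"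
    and x: "inner u v \<noteq> 0" and c: "0 \<le> c" "c \<le> \<bar>f (inner u v)\<bar>"
  shows "\<bar>inner u v\<bar> \<le> \<bar>inner (nudge f u v) v\<bar>"
    and "(1 + c) * \<bar>slope (nudge f u v) v\<bar> \<le> \<bar>slope u v\<bar>"
proof -
  define x where "x = inner u v"
  define g where "g = f x"
  obtain N where N: "1 \<le> N" "N\<^sup>2 = 1 + 2 * (x * g) + g\<^sup>2"
    "\<And>y. inner (nudge f u v) y = (inner u y + g * inner v y) / N"
    "nudge f u v = (1 / N) *\<^sub>R (u + g *\<^sub>R v)"
    by (rule nudgeE[OF f nrm, folded x_def, folded g_def]) (rule that)
  have xg: "0 \<le> x * g" and x0: "x \<noteq> 0" and x1: "\<bar>x\<bar> \<le> 1"
    using nudge_mult_pos[OF f nrm] x abs_inner_le_1[OF nrm] by (auto simp: x_def g_def)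
  have abs_add: "\<bar>x + g\<bar> = \<bar>x\<bar> + \<bar>g\<bar>" using xg by (auto simp: zero_le_mult_iff)
  have inn: "inner (nudge f u v) v = (x + g) / N"
    using nrm by (simp add: N(3) x_def norm_eq_1)
  have crs: "cross2 (nudge f u v) v = cross2 u v / N"
    using N(1) by (simp add: N(4) cross2_def field_simps)
  \<comment> \<open>The difference of the squares factors, which shows that normalizing does not
    undo the growth of the cosine.\<close>
  have "(x * N)\<^sup>2 + (2 * (x * g) + g\<^sup>2) * (1 - x\<^sup>2) = (x + g)\<^sup>2"
    unfolding power_mult_distrib N(2) by (simp add: power2_eq_square algebra_simps)
  moreover have "0 \<le> (2 * (x * g) + g\<^sup>2) * (1 - x\<^sup>2)"
    using xg x1 by (intro mult_nonneg_nonneg) (auto simp: abs_square_le_1)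
  ultimately have "\<bar>x * N\<bar> \<le> \<bar>x + g\<bar>" by (simp add: abs_le_square_iff)
  then show "\<bar>inner u v\<bar> \<le> \<bar>inner (nudge f u v) v\<bar>"
    using N(1) unfolding inn by (simp add: x_def abs_mult field_simps)
  have sl: "slope (nudge f u v) v = cross2 u v / (x + g)"
    using N(1) unfolding slope_def inn crs by simp
  have "(1 + c) * \<bar>x\<bar> \<le> \<bar>x + g\<bar>"
  proof -
    have "c * \<bar>x\<bar> \<le> c * 1" using c x1 by (intro mult_left_mono) auto
    then show ?thesis unfolding abs_add using c(2) by (simp add: g_def x_def algebra_simps)
  qed
  then have "\<bar>cross2 u v\<bar> * ((1 + c) * \<bar>x\<bar>) \<le> \<bar>cross2 u v\<bar> * \<bar>x + g\<bar>"
    by (intro mult_left_mono) auto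
  moreover have "0 < \<bar>x + g\<bar>" unfolding abs_add using x0 by simp
  ultimately show "(1 + c) * \<bar>slope (nudge f u v) v\<bar> \<le> \<bar>slope u v\<bar>"
    using x0 unfolding sl unfolding slope_def x_def[symmetric] abs_divide
    by (simp add: pos_divide_le_eq pos_le_divide_eq mult_ac)
qed

section \<open>Repeated pulls towards one agent\<close>

text \<open>The cosine never drops below \<open>m\<close>, so the same \<open>c\<close> works in
  every repetition.\<close>

lemma nudge_pow_slope:
  assumes f: "stable f" and nrm: "norm u = 1" "norm v = 1"
    and x: "m \<le> \<bar>inner u v\<bar>" "0 < m"
    and c: "0 \<le> c" "\<And>A. m \<le> \<bar>A\<bar> \<Longrightarrow> \<bar>A\<bar> \<le> 1 \<Longrightarrow> c \<le> \<bar>f A\<bar>"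
  defines "un \<equiv> \<lambda>k. ((\<lambda>u. nudge f u v) ^^ k) u"
  shows "norm (un k) = 1" "m \<le> \<bar>inner (un k) v\<bar>" "(1 + c) ^ k * \<bar>slope (un k) v\<bar> \<le> \<bar>slope u v\<bar>"
proof -
  have "norm (un k) = 1 \<and> m \<le> \<bar>inner (un k) v\<bar> \<and> (1 + c) ^ k * \<bar>slope (un k) v\<bar> \<le> \<bar>slope u v\<bar>"
  proof (induction k)
    case 0
    then show ?case using nrm x by (simp add: un_def)
  next
    case (Suc k)
    have "inner (un k) v \<noteq> 0" "c \<le> \<bar>f (inner (un k) v)\<bar>"
      using Suc x c nrm by (auto intro!: c(2) abs_inner_le_1)
    note * = nudge_slope[OF f _ nrm(2) this(1) c(1) this(2)]
    have "(1 + c) ^ k * ((1 + c) * \<bar>slope (un (Suc k)) v\<bar>) \<le> (1 + c) ^ k * \<bar>slope (un k) v\<bar>"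
      using *(2) Suc c(1) by (intro mult_left_mono) (auto simp: un_def)
    then show ?case
      using Suc * norm_nudge[OF f _ nrm(2)] by (auto simp: un_def mult_ac intro: order_trans)
  qed
  then show "norm (un k) = 1" "m \<le> \<bar>inner (un k) v\<bar>"
    "(1 + c) ^ k * \<bar>slope (un k) v\<bar> \<le> \<bar>slope u v\<bar>" by auto
qed

lemma fold_update_sweeps:
  assumes "distinct xs" "j \<notin> set xs"
  shows "fold (update f) (concat (replicate k (map (\<lambda>i. (i, j)) xs))) U =
    (\<lambda>i. if i \<in> set xs then ((\<lambda>u. nudge f u (U j)) ^^ k) (U i) else U i)"
proof (induction k arbitrary: U)
  case (Suc k)
  then show ?case
    using assms by (simp add: fold_update_sweep fun_eq_iff
        funpow_swap1[of "\<lambda>u. nudge f u (U j)", symmetric])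
qed auto

text \<open>The factor 16 turns the spread 4 \<Delta> from \<open>abs_slope_le\<close> into the
  \<Delta> / 4 that \<open>opposite_clusters\<close> asks for. The length bound does not involve the
  positions of the opinions.\<close>

lemma pull_word:
  assumes f: "stable f" and c: "0 \<le> c" "\<forall>A. 1/2 \<le> \<bar>A\<bar> \<and> \<bar>A\<bar> \<le> 1 \<longrightarrow> c \<le> \<bar>f A\<bar>"
    and k: "16 \<le> (1 + c) ^ k"
    and U: "is_config n U" and j: "j < n" and X: "X \<subseteq> {..<n}"
    and near: "\<forall>i\<in>X. 1/2 \<le> \<bar>inner (U i) (U j)\<bar>"
  obtains w where "length w \<le> k * n" "set w \<subseteq> interactions n"
    "\<And>i. i \<notin> X \<Longrightarrow> fold (update f) w U i = U i" "fold (update f) w U j = U j"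
    "\<And>i. i \<in> X \<Longrightarrow> 1/2 \<le> \<bar>inner (fold (update f) w U i) (U j)\<bar>"
    "\<And>i. i \<in> X \<Longrightarrow> \<bar>slope (fold (update f) w U i) (U j)\<bar> \<le> \<bar>slope (U i) (U j)\<bar> / 16"
proof -
  \<comment> \<open>An agent cannot influence itself, so \<open>j\<close> is left out of the word;
    its slope to itself is 0.\<close>
  define xs where "xs = sorted_list_of_set (X - {j})"
  have "finite X" using X finite_subset by blast
  then have xs: "distinct xs" "set xs = X - {j}" by (auto simp: xs_def)
  define w where "w = concat (replicate k (map (\<lambda>i. (i, j)) xs))"
  have "length xs \<le> n"
    using xs X distinct_card[OF xs(1)] card_mono[of "{..<n}" "X - {j}"] by auto
  then have "length w \<le> k * n" by (simp add: w_def length_concat sum_list_replicate)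
  moreover have "set w \<subseteq> interactions n"
    using xs X j by (auto simp: w_def interactions_def)
  moreover have V: "fold (update f) w U =
      (\<lambda>i. if i \<in> X - {j} then ((\<lambda>u. nudge f u (U j)) ^^ k) (U i) else U i)"
    unfolding w_def using xs by (subst fold_update_sweeps) auto
  moreover have nrm: "norm (U i) = 1" if "i < n" for i
    using U that by (auto simp: is_config_def opinion_def)
  have "1/2 \<le> \<bar>inner (fold (update f) w U i) (U j)\<bar> \<and>
      \<bar>slope (fold (update f) w U i) (U j)\<bar> \<le> \<bar>slope (U i) (U j)\<bar> / 16" if "i \<in> X" for i
  proof (cases "i = j")
    case True
    then show ?thesis using nrm[OF j] by (simp add: V slope_self norm_eq_1)
  next
    case False
    have "i < n" using X that by auto
    define u where "u = ((\<lambda>u. nudge f u (U j)) ^^ k) (U i)"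
    have *: "1/2 \<le> \<bar>inner u (U j)\<bar>" "(1 + c) ^ k * \<bar>slope u (U j)\<bar> \<le> \<bar>slope (U i) (U j)\<bar>"
      using nudge_pow_slope[OF f nrm[OF \<open>i < n\<close>] nrm[OF j] bspec[OF near that] _ c(1)] c(2)
      unfolding u_def by auto
    have "16 * \<bar>slope u (U j)\<bar> \<le> (1 + c) ^ k * \<bar>slope u (U j)\<bar>"
      using k by (intro mult_right_mono) auto
    then show ?thesis using * False that by (simp add: V u_def[symmetric])
  qed
  ultimately show ?thesis by (intro that[of w]) auto
qed

text \<open>The factor \<open>1 + slope u e * slope w e\<close> is at least 3/4, so only the signs
  relative to \<open>e\<close> matter.\<close>

lemma same_cluster:
  assumes "norm e = 1" "inner u e \<noteq> 0" "inner w e \<noteq> 0"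
    and "\<bar>slope u e\<bar> \<le> 1/2" "\<bar>slope w e\<bar> \<le> 1/2"
  shows "0 < sgn (inner u e) * sgn (inner w e) * inner u w"
proof -
  have "\<bar>slope u e * slope w e\<bar> \<le> 1/2 * (1/2)"
    unfolding abs_mult using assms by (intro mult_mono) auto
  then have "0 < 1 + slope u e * slope w e" by linarith
  then have "0 < \<bar>inner u e\<bar> * \<bar>inner w e\<bar> * (1 + slope u e * slope w e)"
    using assms by simp
  then show ?thesis
    unfolding inner_slopes[OF assms(1-3)] abs_sgn by (simp add: mult_ac)
qed

text \<open>The main term is \<open>a = inner e h\<close>; the errors are at most
  \<open>\<bar>a\<bar> / 16\<close> and \<open>\<bar>a\<bar> / 2\<close>. The slopes are measured
  against \<open>\<bar>a\<bar>\<close> because the clusters may be almost orthogonal.\<close>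

lemma opposite_clusters:
  assumes nrm: "norm e = 1" "norm h = 1" "inner u e \<noteq> 0" "inner w h \<noteq> 0" and "inner e h \<noteq> 0"
    and slopes: "\<bar>slope u e\<bar> \<le> \<bar>inner e h\<bar> / 4" "\<bar>slope w h\<bar> \<le> \<bar>inner e h\<bar> / 4"
  shows "0 < sgn (inner u e) * (sgn (inner w h) * sgn (inner e h)) * inner u w"
proof -
  define a where "a = inner e h"
  define r where "r = inner e h * (1 + slope u e * slope w h) + cross2 e h * (slope w h - slope u e)"
  have a1: "\<bar>a\<bar> \<le> 1" unfolding a_def by (rule abs_inner_le_1[OF nrm(1,2)])
  have "\<bar>slope u e * slope w h\<bar> \<le> 1/4 * (1/4)"
    unfolding abs_mult using slopes a1 a_def by (intro mult_mono) auto
  then have "\<bar>a * (slope u e * slope w h)\<bar> \<le> \<bar>a\<bar> * (1/16)"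
    unfolding abs_mult[of a] by (intro mult_left_mono) auto
  moreover have "\<bar>cross2 e h * (slope w h - slope u e)\<bar> \<le> 1 * (\<bar>a\<bar> / 2)"
    unfolding abs_mult
    using slopes abs_cross2_le_1[OF nrm(1,2)] abs_triangle_ineq4[of "slope w h" "slope u e"] a_def
    by (intro mult_mono) auto
  moreover have "r = a + a * (slope u e * slope w h) + cross2 e h * (slope w h - slope u e)"
    unfolding r_def a_def by (simp add: algebra_simps)
  moreover have "a \<noteq> 0" using assms by (simp add: a_def)
  ultimately have "0 < sgn a * r"
    by (auto simp: sgn_if abs_if split: if_splits)
  then have "0 < \<bar>inner u e\<bar> * \<bar>inner w h\<bar> * (sgn a * r)"
    using nrm by simp
  then show ?thesis
    unfolding inner_slopes2[OF nrm] r_def[symmetric] abs_sgn a_def by (simp add: mult_ac)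
qed

definition aligned :: "nat \<Rightarrow> config \<Rightarrow> bool" where
  "aligned n U \<longleftrightarrow> (\<exists>s m. (\<forall>k. s k = 1 \<or> s k = -1) \<and> 0 < m \<and> coherent n s m U)"

lemma alignedI:
  assumes s: "\<And>k. k < n \<Longrightarrow> s k = 1 \<or> s k = -1"
    and pos: "\<And>k l. k < n \<Longrightarrow> l < n \<Longrightarrow> 0 < s k * s l * inner (U k) (U l)"
  shows "aligned n U"
proof -
  let ?g = "\<lambda>(k, l). s k * s l * inner (U k) (U l)"
  \<comment> \<open>The inserted 1 keeps the set nonempty even for \<open>n = 0\<close>.\<close>
  define m where "m = Min (insert 1 (?g ` ({..<n} \<times> {..<n})))"
  define s' where "s' k = (if k < n then s k else 1)" for k
  have "0 < m" unfolding m_def using pos by (subst Min_gr_iff) auto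
  moreover have "m \<le> s k * s l * inner (U k) (U l)" if "k < n" "l < n" for k l
    unfolding m_def using that by (intro Min_le) (auto intro!: image_eqI[of _ _ "(k, l)"])
  then have "coherent n s' m U" by (simp add: coherent_def s'_def)
  ultimately show ?thesis
    unfolding aligned_def using s by (intro exI[of _ s'] exI[of _ m]) (auto simp: s'_def)
qed

text \<open>A tangent of at most 1/2 means a squared cosine of at least 4/5, so the product is at
  least 4/5 * 3/4 = 3/5.\<close>

lemma abs_inner_ge_half_if_slopes:
  assumes nrm: "norm u = 1" "norm w = 1" "norm e = 1"
    and u: "inner u e \<noteq> 0" "\<bar>slope u e\<bar> \<le> 1/2" and w: "inner w e \<noteq> 0" "\<bar>slope w e\<bar> \<le> 1/2"
  shows "1/2 \<le> \<bar>inner u w\<bar>"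
proof -
  have large: "4/5 \<le> (inner x e)\<^sup>2" if "norm x = 1" "inner x e \<noteq> 0" "\<bar>slope x e\<bar> \<le> 1/2" for x
  proof -
    have "(slope x e)\<^sup>2 \<le> (1/2)\<^sup>2" using that(3) by (intro power2_le_iff_abs_le[THEN iffD2]) auto
    then have "(inner x e)\<^sup>2 * (slope x e)\<^sup>2 \<le> (inner x e)\<^sup>2 * (1/4)"
      by (intro mult_left_mono) (auto simp: power2_eq_square)
    moreover have "(inner x e)\<^sup>2 + (inner x e)\<^sup>2 * (slope x e)\<^sup>2 = 1"
      using inner_sq_plus_cross2_sq[OF that(1) nrm(3)]
      by (simp add: cross2_slope that power_mult_distrib mult_ac)
    ultimately show ?thesis by linarith
  qed
  have "(4/5)\<^sup>2 \<le> (inner u e)\<^sup>2 * (inner w e)\<^sup>2"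
    unfolding power2_eq_square[of "4/5"]
    using large[OF nrm(1) u] large[OF nrm(2) w] by (intro mult_mono) auto
  then have *: "4/5 \<le> \<bar>inner u e * inner w e\<bar>"
    by (metis abs_le_square_iff abs_of_nonneg power_mult_distrib zero_le_divide_iff zero_le_numeral)
  have "\<bar>slope u e * slope w e\<bar> \<le> 1/2 * (1/2)"
    unfolding abs_mult using u w by (intro mult_mono) auto
  then have "3/4 \<le> \<bar>1 + slope u e * slope w e\<bar>" by linarith
  then have "4/5 * (3/4) \<le> \<bar>inner u w\<bar>"
    unfolding inner_slopes[OF nrm(3) u(1) w(1)] abs_mult[of "inner u e * inner w e"]
    using * by (intro mult_mono) auto
  then show ?thesis by simp
qed

text \<open>In the plane the orthogonal complement of \<open>e\<close> is one line, and both
  opinions are within 30 degrees of it. Numerically, 3/4 from the sines minus 1/4 from the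
  cosines.\<close>

lemma abs_inner_ge_half_if_both_oblique:
  fixes u w e :: "real ^ 2"
  assumes nrm: "norm u = 1" "norm w = 1" "norm e = 1"
    and "\<bar>inner u e\<bar> \<le> 1/2" "\<bar>inner w e\<bar> \<le> 1/2"
  shows "1/2 \<le> \<bar>inner u w\<bar>"
proof -
  have large: "3/4 \<le> (cross2 x e)\<^sup>2" if "norm x = 1" "\<bar>inner x e\<bar> \<le> 1/2" for x :: "real ^ 2"
  proof -
    have "(inner x e)\<^sup>2 \<le> (1/2)\<^sup>2" using that(2) by (intro power2_le_iff_abs_le[THEN iffD2]) auto
    then show ?thesis
      using inner_sq_plus_cross2_sq[OF that(1) nrm(3)] by (simp add: power2_eq_square)
  qed
  have "(3/4)\<^sup>2 \<le> (cross2 u e)\<^sup>2 * (cross2 w e)\<^sup>2"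
    unfolding power2_eq_square[of "3/4"] using large assms by (intro mult_mono) auto
  then have "3/4 \<le> \<bar>cross2 u e * cross2 w e\<bar>"
    by (metis abs_le_square_iff abs_of_nonneg power_mult_distrib zero_le_divide_iff zero_le_numeral)
  moreover have "\<bar>inner u e * inner w e\<bar> \<le> 1/2 * (1/2)"
    unfolding abs_mult using assms by (intro mult_mono) auto
  ultimately show ?thesis unfolding inner_frame[OF nrm(3), of u w] by linarith
qed

text \<open>Two opinions almost orthogonal to the same \<open>e\<close> are almost parallel: the
  sine of their angle is at most 2 \<Delta>, their cosine at least 1/2 in absolute value.\<close>

lemma abs_slope_le:
  assumes nrm: "norm u = 1" "norm w = 1" "norm e = 1"
    and "1/2 \<le> \<bar>inner u w\<bar>" and \<Delta>: "\<bar>inner u e\<bar> \<le> \<Delta>" "\<bar>inner w e\<bar> \<le> \<Delta>"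
  shows "\<bar>slope u w\<bar> \<le> 4 * \<Delta>"
proof -
  have "\<bar>cross2 u e * inner w e\<bar> \<le> 1 * \<Delta>"
    unfolding abs_mult using abs_cross2_le_1[OF nrm(1,3)] \<Delta> by (intro mult_mono) auto
  moreover have "\<bar>cross2 w e * inner u e\<bar> \<le> 1 * \<Delta>"
    unfolding abs_mult using abs_cross2_le_1[OF nrm(2,3)] \<Delta> by (intro mult_mono) auto
  ultimately have "\<bar>cross2 u w\<bar> \<le> 2 * \<Delta>" unfolding cross2_frame[OF nrm(3), of u w] by linarith
  moreover have "0 \<le> \<Delta>" using \<Delta> by linarith
  then have "4 * \<Delta> * (1/2) \<le> 4 * \<Delta> * \<bar>inner u w\<bar>" using assms by (intro mult_left_mono) auto
  ultimately have "\<bar>cross2 u w\<bar> \<le> 4 * \<Delta> * \<bar>inner u w\<bar>" by linarith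
  then show ?thesis
    using assms(4) unfolding slope_def by (simp add: divide_le_eq)
qed

lemma is_config_norm: "is_config n U \<Longrightarrow> i < n \<Longrightarrow> norm (U i) = 1"
  by (simp add: is_config_def opinion_def)

lemma two_clusters_word:
  assumes f: "stable f" and c: "0 \<le> c" "\<forall>A. 1/2 \<le> \<bar>A\<bar> \<and> \<bar>A\<bar> \<le> 1 \<longrightarrow> c \<le> \<bar>f A\<bar>"
    and k: "16 \<le> (1 + c) ^ k"
    and V: "is_config n V" "\<not> separable n V"
    and AB: "A \<union> B = {..<n}" "A \<inter> B = {}" "A \<noteq> {}" "B \<noteq> {}"
    and AA: "\<forall>i\<in>A. \<forall>j\<in>A. 1/2 \<le> \<bar>inner (V i) (V j)\<bar>"
    and BB: "\<forall>i\<in>B. \<forall>j\<in>B. 1/2 \<le> \<bar>inner (V i) (V j)\<bar>"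
  obtains w where "length w \<le> 2 * (k * n)" "set w \<subseteq> interactions n"
    "aligned n (fold (update f) w V)"
proof -
  let ?h = "\<lambda>(i, j). \<bar>inner (V i) (V j)\<bar>"
  have fin: "finite A" "finite B" using AB(1) by (metis finite_Un finite_lessThan)+
  then have "Max (?h ` (A \<times> B)) \<in> ?h ` (A \<times> B)" using AB by (intro Max_in) auto
  then obtain p where "p \<in> A \<times> B" "Max (?h ` (A \<times> B)) = ?h p" by (rule imageE)
  then obtain a b where ab: "a \<in> A" "b \<in> B" and Max: "Max (?h ` (A \<times> B)) = ?h (a, b)"
    by (cases p) auto
  define \<Delta> where "\<Delta> = \<bar>inner (V a) (V b)\<bar>"
  have le_\<Delta>: "\<bar>inner (V i) (V j)\<bar> \<le> \<Delta>" if "i \<in> A" "j \<in> B" for i j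
  proof -
    have "?h (i, j) \<le> Max (?h ` (A \<times> B))" using fin that by (intro Max_ge) auto
    then show ?thesis using Max by (simp add: \<Delta>_def)
  qed
  \<comment> \<open>Non-separability enters here: if the maximum vanished, \<open>A\<close> and
    \<open>B\<close> would be mutually orthogonal.\<close>
  have \<Delta>_pos: "inner (V a) (V b) \<noteq> 0"
  proof
    assume "inner (V a) (V b) = 0"
    then have "inner (V i) (V j) = 0" if "i \<in> A" "j \<in> B" for i j
      using le_\<Delta>[OF that] by (simp add: \<Delta>_def)
    then have "separable n V"
      unfolding separable_def using AB by (intro exI[of _ A] exI[of _ B]) auto
    with V(2) show False ..
  qed
  have lt: "i < n" if "i \<in> A \<or> i \<in> B" for i using AB(1) that by auto
  have sub: "A \<subseteq> {..<n}" "B \<subseteq> {..<n}" using AB(1) by auto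
  have nrm: "norm (V i) = 1" if "i \<in> A \<or> i \<in> B" for i
    using is_config_norm[OF V(1) lt[OF that]] .
  have a_lt: "a < n" and b_lt: "b < n" using lt ab by auto
  have nearA: "\<forall>i\<in>A. 1/2 \<le> \<bar>inner (V i) (V a)\<bar>" using AA ab by blast
  obtain w1 where w1: "length w1 \<le> k * n" "set w1 \<subseteq> interactions n"
    "\<And>i. i \<notin> A \<Longrightarrow> fold (update f) w1 V i = V i"
    "\<And>i. i \<in> A \<Longrightarrow> 1/2 \<le> \<bar>inner (fold (update f) w1 V i) (V a)\<bar>"
    "\<And>i. i \<in> A \<Longrightarrow> \<bar>slope (fold (update f) w1 V i) (V a)\<bar> \<le> \<bar>slope (V i) (V a)\<bar> / 16"
    by (rule pull_word[OF f c k V(1) a_lt sub(1) nearA]) (rule that)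
  define W where "W = fold (update f) w1 V"
  have WB: "W i = V i" if "i \<in> B" for i unfolding W_def using w1(3) AB(2) that by auto
  have nearB: "\<forall>i\<in>B. 1/2 \<le> \<bar>inner (W i) (W b)\<bar>" using BB ab by (simp add: WB)
  have cfgW: "is_config n W" unfolding W_def by (rule fold_update_invariant(1)[OF f V w1(2)])
  obtain w2 where w2: "length w2 \<le> k * n" "set w2 \<subseteq> interactions n"
    "\<And>i. i \<notin> B \<Longrightarrow> fold (update f) w2 W i = W i"
    "\<And>i. i \<in> B \<Longrightarrow> 1/2 \<le> \<bar>inner (fold (update f) w2 W i) (W b)\<bar>"
    "\<And>i. i \<in> B \<Longrightarrow> \<bar>slope (fold (update f) w2 W i) (W b)\<bar> \<le> \<bar>slope (W i) (W b)\<bar> / 16"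
    by (rule pull_word[OF f c k cfgW b_lt sub(2) nearB]) (rule that)
  define Z where "Z = fold (update f) w2 W"
  have ZA: "inner (Z i) (V a) \<noteq> 0" "\<bar>slope (Z i) (V a)\<bar> \<le> \<Delta> / 4" if "i \<in> A" for i
  proof -
    have Z: "Z i = W i" unfolding Z_def using w2(3) AB(2) that by auto
    show "inner (Z i) (V a) \<noteq> 0" using w1(4)[OF that] by (auto simp: Z W_def)
    \<comment> \<open>The reference is \<open>V b\<close> from the other cluster: by maximality,
      both \<open>V i\<close> and \<open>V a\<close> have product at most \<Delta> with it.\<close>
    have "\<bar>slope (V i) (V a)\<bar> \<le> 4 * \<Delta>"
      using ab that le_\<Delta> AA nrm by (intro abs_slope_le[of _ _ "V b"]) auto
    then show "\<bar>slope (Z i) (V a)\<bar> \<le> \<Delta> / 4" using w1(5)[OF that] by (simp add: Z W_def)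
  qed
  have ZB: "inner (Z i) (V b) \<noteq> 0" "\<bar>slope (Z i) (V b)\<bar> \<le> \<Delta> / 4" if "i \<in> B" for i
  proof -
    show "inner (Z i) (V b) \<noteq> 0" using w2(4)[OF that] by (auto simp: Z_def WB ab)
    have "\<bar>slope (V i) (V b)\<bar> \<le> 4 * \<Delta>"
      using ab that le_\<Delta> BB nrm by (intro abs_slope_le[of _ _ "V a"]) (auto simp: inner_commute)
    then show "\<bar>slope (Z i) (V b)\<bar> \<le> \<Delta> / 4" using w2(5)[OF that] by (simp add: Z_def WB that ab)
  qed
  have "\<Delta> \<le> 1" unfolding \<Delta>_def using ab nrm by (intro abs_inner_le_1) auto
  \<comment> \<open>Each agent gets its side relative to the centre of its own cluster; the extra
    factor for \<open>B\<close> makes the two centres agree.\<close>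
  define s where "s i = (if i \<in> A then sgn (inner (Z i) (V a))
    else sgn (inner (Z i) (V b)) * sgn (inner (V a) (V b)))" for i
  have AB_pos: "0 < s i * s j * inner (Z i) (Z j)" if "i \<in> A" "j \<in> B" for i j
  proof -
    have "j \<notin> A" using AB(2) that by auto
    then show ?thesis
      using opposite_clusters[of "V a" "V b" "Z i" "Z j"] ZA[OF that(1)] ZB[OF that(2)] \<Delta>_pos nrm ab that
      unfolding s_def \<Delta>_def by simp
  qed
  have cover: "i \<in> A \<or> i \<in> B" if "i < n" for i
    using AB(1) that by (metis Un_iff lessThan_iff)
  have "0 < s i * s j * inner (Z i) (Z j)" if "i < n" "j < n" for i j
  proof -
    consider "i \<in> A" "j \<in> A" | "i \<in> A" "j \<in> B" | "i \<in> B" "j \<in> A" | "i \<in> B" "j \<in> B"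
      using cover[OF \<open>i < n\<close>] cover[OF \<open>j < n\<close>] by blast
    then show ?thesis
    proof cases
      case 1
      then show ?thesis
        using same_cluster[of "V a" "Z i" "Z j"] ZA[of i] ZA[of j] \<open>\<Delta> \<le> 1\<close> nrm ab by (simp add: s_def)
    next
      case 2
      then show ?thesis by (rule AB_pos)
    next
      case 3
      then show ?thesis using AB_pos[OF 3(2,1)] by (simp add: inner_commute[of "Z i"] mult_ac)
    next
      case 4
      \<comment> \<open>Within \<open>B\<close> the correcting factor occurs twice and
        cancels.\<close>
      have "sgn (inner (V a) (V b)) * sgn (inner (V a) (V b)) = 1"
        using \<Delta>_pos by (simp add: sgn_if)
      then have ss: "s i * s j = sgn (inner (Z i) (V b)) * sgn (inner (Z j) (V b))"
        using 4 AB(2) by (auto simp: s_def mult_ac sgn_if)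
      show ?thesis
        using same_cluster[of "V b" "Z i" "Z j"] ZB[OF 4(1)] ZB[OF 4(2)] \<open>\<Delta> \<le> 1\<close> nrm ab
        unfolding ss by simp
    qed
  qed
  moreover have "s i = 1 \<or> s i = -1" if "i < n" for i
    using ZA(1)[of i] ZB(1)[of i] \<Delta>_pos cover[OF that]
    by (cases "i \<in> A") (auto simp: s_def sgn_if)
  ultimately have "aligned n Z" by (intro alignedI)
  then show ?thesis
    using w1(1,2) w2(1,2) by (intro that[of "w1 @ w2"]) (auto simp: Z_def W_def)
qed

text \<open>\<open>AE_stream_hits\<close> needs a length bound uniform in \<open>U\<close>. Here
  \<open>k\<close> depends on \<open>f\<close> only, and three pulls suffice: one to agent 0 and two
  for the clusters.\<close>

lemma bounded_word_to_aligned: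
  assumes f: "stable f" and "0 < n"
  shows "\<exists>K. \<forall>U. is_config n U \<and> \<not> separable n U \<longrightarrow>
    (\<exists>w. length w \<le> K \<and> set w \<subseteq> interactions n \<and> aligned n (fold (update f) w U))"
proof -
  obtain c where c: "0 < c" "\<forall>A. 1/2 \<le> \<bar>A\<bar> \<and> \<bar>A\<bar> \<le> 1 \<longrightarrow> c \<le> \<bar>f A\<bar>"
    by (rule stable_bounded_away[OF f, of "1/2"]) (simp, rule that, auto)
  have c': "0 \<le> c" using c by simp
  obtain k where "16 < (1 + c) ^ k" using real_arch_pow[of "1 + c" 16] c by auto
  then have k: "16 \<le> (1 + c) ^ k" by simp
  have "\<exists>w. length w \<le> 3 * (k * n) \<and> set w \<subseteq> interactions n \<and> aligned n (fold (update f) w U)"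
    if U: "is_config n U" "\<not> separable n U" for U
  proof -
    note nrm = is_config_norm[OF U(1)]
    define A where "A = {i. i < n \<and> 1/2 \<le> \<bar>inner (U i) (U 0)\<bar>}"
    define B where "B = {..<n} - A"
    have A: "A \<subseteq> {..<n}" "0 \<in> A"
      using \<open>0 < n\<close> nrm[OF \<open>0 < n\<close>] by (auto simp: A_def norm_eq_1)
    have near: "\<forall>i\<in>A. 1/2 \<le> \<bar>inner (U i) (U 0)\<bar>" by (simp add: A_def)
    obtain w where w: "length w \<le> k * n" "set w \<subseteq> interactions n"
      "\<And>i. i \<notin> A \<Longrightarrow> fold (update f) w U i = U i"
      "\<And>i. i \<in> A \<Longrightarrow> 1/2 \<le> \<bar>inner (fold (update f) w U i) (U 0)\<bar>"
      "\<And>i. i \<in> A \<Longrightarrow> \<bar>slope (fold (update f) w U i) (U 0)\<bar> \<le> \<bar>slope (U i) (U 0)\<bar> / 16"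
      by (rule pull_word[OF f c' c(2) k U(1) \<open>0 < n\<close> A(1) near]) (rule that)
    define V where "V = fold (update f) w U"
    have V: "is_config n V" "\<not> separable n V"
      unfolding V_def using fold_update_invariant[OF f U w(2)] by auto
    note nrmV = is_config_norm[OF V(1)]
    have VA: "inner (V i) (U 0) \<noteq> 0" "\<bar>slope (V i) (U 0)\<bar> \<le> 1/2" if "i \<in> A" for i
    proof -
      show "inner (V i) (U 0) \<noteq> 0" using w(4)[OF that] by (auto simp: V_def)
      have "i < n" using that by (simp add: A_def)
      \<comment> \<open>With \<Delta> = 1 the bounds on products hold trivially; the pull then
        leaves at most 4/16.\<close>
      then have "\<bar>slope (U i) (U 0)\<bar> \<le> 4 * 1"
        using that nrm \<open>0 < n\<close>
        by (intro abs_slope_le[of _ _ "U 0"] abs_inner_le_1) (auto simp: A_def)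
      then show "\<bar>slope (V i) (U 0)\<bar> \<le> 1/2" using w(5)[OF that] by (simp add: V_def)
    qed
    show ?thesis
    proof (cases "B = {}")
      case True
      then have inA: "i \<in> A" if "i < n" for i using that by (auto simp: B_def)
      have "aligned n V"
      proof (rule alignedI)
        show "sgn (inner (V i) (U 0)) = 1 \<or> sgn (inner (V i) (U 0)) = -1" if "i < n" for i
          using VA(1)[OF inA[OF that]] by (simp add: sgn_if)
        show "0 < sgn (inner (V i) (U 0)) * sgn (inner (V j) (U 0)) * inner (V i) (V j)"
          if "i < n" "j < n" for i j
          using that VA inA nrm[OF \<open>0 < n\<close>] by (intro same_cluster) auto
      qed
      then show ?thesis using w(1,2) by (intro exI[of _ w]) (auto simp: V_def)
    next
      case False
      have AB: "A \<union> B = {..<n}" "A \<inter> B = {}" "A \<noteq> {}" using A by (auto simp: B_def)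
      have AA: "\<forall>i\<in>A. \<forall>j\<in>A. 1/2 \<le> \<bar>inner (V i) (V j)\<bar>"
        using VA nrm \<open>0 < n\<close> A(1) nrmV
        by (intro ballI abs_inner_ge_half_if_slopes[of _ _ "U 0"]) auto
      \<comment> \<open>The word \<open>w\<close> does not touch \<open>B\<close>, so its opinions
        are still at least 60 degrees from \<open>U 0\<close>.\<close>
      have BB: "\<forall>i\<in>B. \<forall>j\<in>B. 1/2 \<le> \<bar>inner (V i) (V j)\<bar>"
        using w(3) nrm \<open>0 < n\<close>
        by (intro ballI abs_inner_ge_half_if_both_oblique[of _ _ "U 0"]) (auto simp: B_def A_def V_def)
      obtain w' where "length w' \<le> 2 * (k * n)" "set w' \<subseteq> interactions n"
        "aligned n (fold (update f) w' V)"
        by (rule two_clusters_word[OF f c' c(2) k V AB False AA BB]) (rule that)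
      then show ?thesis using w(1,2) by (intro exI[of _ "w @ w'"]) (auto simp: V_def)
    qed
  qed
  then show ?thesis by blast
qed

section \<open>Combination of the almost sure events\<close>

theorem mainTheorem1:
  fixes n :: nat and f :: "real \<Rightarrow> real" and D :: "(nat \<times> nat) pmf" and U0 :: config
  assumes "n \<ge> 2"
    and "stable f"
    and "set_pmf D = interactions n"
    and "is_config n U0"
    and "\<not> separable n U0"
  shows "AE I in stream_space (measure_pmf D). polarizes n (traj f U0 I)"
proof -
  have "0 < n" using assms by simp
  have "interactions n \<subseteq> {..<n} \<times> {..<n}" by (auto simp: interactions_def)
  then have fin: "finite (set_pmf D)" unfolding assms(3) by (rule finite_subset) auto
  obtain K where K: "\<And>U. is_config n U \<Longrightarrow> \<not> separable n U \<Longrightarrow>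
    \<exists>w. length w \<le> K \<and> set w \<subseteq> interactions n \<and> aligned n (fold (update f) w U)"
    using bounded_word_to_aligned[OF assms(2) \<open>0 < n\<close>] by blast
  let ?w = "map (\<lambda>i. (i, 0 :: nat)) [1..<n]"
  have "AE I in stream_space (measure_pmf D). \<exists>t. fold (update f) (stake t I) U0 \<in> Collect (aligned n)"
    by (rule AE_stream_hits[where P = "{U. is_config n U \<and> \<not> separable n U}" and K = K])
      (use fin assms K in \<open>auto simp: is_config_update not_separable_update\<close>)
  moreover have "AE I in stream_space (measure_pmf D).
      \<forall>N. \<exists>t\<ge>N. stake (length ?w) (sdrop t I) = ?w"
    by (rule AE_stream_word_infinitely_often[OF fin])
      (auto simp: assms(3) interactions_def)
  moreover have "AE I in stream_space (measure_pmf D). stream_all (\<lambda>x. x \<in> interactions n) I"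
    by (rule prob_space.AE_stream_all[OF prob_space_measure_pmf])
      (auto simp: AE_measure_pmf_iff assms(3))
  ultimately show ?thesis
  proof eventually_elim
    \<comment> \<open>From here on the argument is deterministic: a coherent time, infinitely many
      sweeps and admissible letters throughout.\<close>
    case (elim I)
    obtain t s m where "\<And>k. s k = 1 \<or> s k = -1" "0 < m" "coherent n s m (traj f U0 I t)"
      using elim(1) unfolding aligned_def traj_eq_fold by auto
    moreover have "\<And>t. I !! t \<in> interactions n"
      using elim(3) by (simp add: stream_all_def)
    ultimately show ?case
      using elim(2) assms(2,4) \<open>0 < n\<close>
      by (intro polarizes_if_coherent[of f n U0 I s m t]) auto
  qed
qed

end
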